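(* A graph $G=(V,E)$ is a connected graph with metamour period $3$ if and only if it is isomorphic to either $C_7$ or $C_9$.
   Context: All graphs are finite and simple; $C_n$ is the cycle graph on $n$ vertices. The metamour graph $\operatorname{M}(G)$ has vertex set $V(G)$, with $x,y$ adjacent iff $d_G(x,y)=2$ (graph distance); $\operatorname{M}^0(G)=G$ and $\operatorname{M}^{k+1}(G)=\operatorname{M}(\operatorname{M}^k(G))$. $G$ has metamour period $k\in\mathbb{Z}^+$ if $\operatorname{M}^k(G)=G$ (equality as labeled graphs) and $k$ is the minimal positive integer with this property. *)

theory Defs
  imports "Graph_Theory.Graph_Theory"
begin

text \<open>
  A finite simple graph is a \<open>pair_graph\<close>: a finite vertex set together with a symmetric and
  irreflexive relation on it, the undirected edge \<open>{x, y}\<close> being represented by the two arcs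
  \<open>(x, y)\<close> and \<open>(y, x)\<close>.
\<close>

text \<open>
  The infimum of the lengths of the walks from \<open>u\<close> to \<open>v\<close>, which is \<open>\<infinity>\<close> if there is no such walk.
\<close>
definition graph_dist :: "'a pair_pre_digraph \<Rightarrow> 'a \<Rightarrow> 'a \<Rightarrow> ereal" where
  "graph_dist G u v = wf_digraph.\<mu> (with_proj G) (\<lambda>_. 1) u v"

definition metamour_graph :: "'a pair_pre_digraph \<Rightarrow> 'a pair_pre_digraph" where
  "metamour_graph G =
     \<lparr> pverts = pverts G,
       parcs = {(x, y). x \<in> pverts G \<and> y \<in> pverts G \<and> graph_dist G x y = 2} \<rparr>"

text \<open>
  Equality of graphs here is equality of vertex sets and edge sets, not isomorphism.
\<close>
definition has_metamour_period :: "'a pair_pre_digraph \<Rightarrow> nat \<Rightarrow> bool" where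
  "has_metamour_period G k \<longleftrightarrow>
     0 < k \<and> (metamour_graph ^^ k) G = G \<and>
     (\<forall>j. 0 < j \<and> j < k \<longrightarrow> (metamour_graph ^^ j) G \<noteq> G)"

text \<open>The cycle on the vertices \<open>0, \<dots>, n - 1\<close>; a simple graph only for \<open>n \<ge> 3\<close>.\<close>
definition cycle_graph :: "nat \<Rightarrow> nat pair_pre_digraph" where
  "cycle_graph n =
     \<lparr> pverts = {..<n},
       parcs = {(i, j). i < n \<and> j < n \<and> (j = (i + 1) mod n \<or> i = (j + 1) mod n)} \<rparr>"

lemma pair_graph_cycle_graph:
  assumes "n \<ge> 3"
  shows "pair_graph (cycle_graph n)"
proof -
  have "parcs (cycle_graph n) \<subseteq> {..<n} \<times> {..<n}"
    by (auto simp: cycle_graph_def)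
  then have fin: "finite (parcs (cycle_graph n))"
    by (rule finite_subset) simp
  show ?thesis
    using assms fin
    by unfold_locales
      (auto simp: cycle_graph_def symmetric_def sym_def mod_Suc split: if_splits)
qed

lemma (in pair_wf_digraph) graph_dist_eq_2_iff:
  "graph_dist G x y = 2 \<longleftrightarrow>
     x \<noteq> y \<and> (x, y) \<notin> parcs G \<and> (\<exists>z. (x, z) \<in> parcs G \<and> (z, y) \<in> parcs G)"
    (is "?L \<longleftrightarrow> ?R")
proof -
  have cost: "awalk_cost (\<lambda>_. 1) p = real (length p)" for p :: "('a \<times> 'a) list"
    by (induction p) auto
  have dist: "graph_dist G x y = (INF p\<in>{p. awalk x p y}. ereal (real (length p)))"
    unfolding graph_dist_def \<mu>_def cost ..
  have upper: "graph_dist G x y \<le> ereal (real (length p))" if "awalk x p y" for p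
    unfolding dist using that by (intro INF_lower) simp
  show ?thesis
  proof
    assume L: ?L
    have ge2: "length p \<ge> 2" if "awalk x p y" for p
      using upper[OF that] L by simp
    have "\<exists>p. awalk x p y \<and> length p < 3"
    proof (rule ccontr)
      assume *: "\<not> ?thesis"
      have "ereal 3 \<le> graph_dist G x y"
        unfolding dist
      proof (rule INF_greatest)
        fix p assume "p \<in> {p. awalk x p y}"
        with * have "length p \<ge> 3" by force
        then show "ereal 3 \<le> ereal (real (length p))" by simp
      qed
      with L show False by simp
    qed
    then obtain p where p: "awalk x p y" "length p < 3" by blast
    with ge2[OF p(1)] have "length p = 2" by simp
    then obtain a b where "p = [a, b]"
      by (auto simp: numeral_2_eq_2 length_Suc_conv)
    with p(1) have z: "(x, snd a) \<in> parcs G" "(snd a, y) \<in> parcs G"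
      by (cases a; cases b; auto simp: awalk_def)+
    have "x \<noteq> y"
    proof
      assume "x = y"
      with z have "awalk x [] y" by (auto simp: awalk_def dest: in_arcsD1)
      from ge2[OF this] show False by simp
    qed
    moreover have "(x, y) \<notin> parcs G"
    proof
      assume "(x, y) \<in> parcs G"
      then have "awalk x [(x, y)] y" by (auto simp: awalk_def dest: in_arcsD1)
      from ge2[OF this] show False by simp
    qed
    ultimately show ?R using z by blast
  next
    assume ?R
    then obtain z where z: "x \<noteq> y" "(x, y) \<notin> parcs G" "(x, z) \<in> parcs G" "(z, y) \<in> parcs G"
      by blast
    have "awalk x [(x, z), (z, y)] y"
      using z by (auto simp: awalk_def dest: in_arcsD1)
    from upper[OF this] have le: "graph_dist G x y \<le> 2" by simp
    have "ereal 2 \<le> graph_dist G x y"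
      unfolding dist
    proof (rule INF_greatest)
      fix p assume "p \<in> {p. awalk x p y}"
      then have p: "awalk x p y" by simp
      have "length p \<ge> 2"
      proof (rule ccontr)
        assume "\<not> length p \<ge> 2"
        then consider "p = []" | a where "p = [a]"
          by (cases p) (auto simp: numeral_2_eq_2 less_Suc_eq_0_disj not_le length_Suc_conv)
        then show False
        proof cases
          case 1
          with p z show False by (auto simp: awalk_def)
        next
          case 2
          with p z show False by (cases a) (auto simp: awalk_def)
        qed
      qed
      then show "ereal 2 \<le> ereal (real (length p))" by simp
    qed
    with le show ?L by simp
  qed
qed

lemma pair_graph_metamour_graph:
  assumes "pair_graph G"
  shows "pair_graph (metamour_graph G)"
proof -
  interpret pair_graph G by fact
  have sym: "(u, v) \<in> parcs G \<longleftrightarrow> (v, u) \<in> parcs G" for u v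
    using pair_sym_arcs by (auto simp: symmetric_def sym_def)
  have "parcs (metamour_graph G) \<subseteq> pverts G \<times> pverts G"
    by (auto simp: metamour_graph_def)
  then have fin: "finite (parcs (metamour_graph G))"
    by (rule finite_subset) (simp add: pair_finite_verts)
  show ?thesis
    using fin pair_finite_verts
    by unfold_locales
      (auto simp: metamour_graph_def graph_dist_eq_2_iff symmetric_def sym_def
            simp del: numeral_eq_ereal intro: sym[THEN iffD1])
qed

end

theory Submission
  imports Defs "HOL-Number_Theory.Cong"
begin

text \<open>
  Let \<open>A\<close>, \<open>B\<close>, \<open>C\<close> be the adjacency relations of \<open>G\<close>, \<open>M(G)\<close> and \<open>M\<^sup>2(G)\<close>. If \<open>M\<^sup>3(G) = G\<close>, then
  each of the three arises from the previous one, cyclically, by the same rule: the three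
  relations are disjoint, two \<open>A\<close>-edges at a common vertex are closed by an \<open>A\<close>-edge or a \<open>B\<close>-edge,
  and every \<open>B\<close>-edge is spanned by such a pair of \<open>A\<close>-edges. Everything is local and symmetric
  under rotating \<open>A\<close>, \<open>B\<close>, \<open>C\<close>.

  The rules rule out \<open>A\<close>-triangles (\<open>no_triangle\<close>): following the required paths from one leads
  to a contradiction after a few steps. Hence the \<open>A\<close>-neighbours of a vertex are pairwise
  \<open>B\<close>-adjacent, and as there are no \<open>B\<close>-triangles either, degrees are at most two
  (\<open>degree_le_2\<close>); a short argument shows that no vertex has degree one (\<open>no_end\<close>). So one can walk
  in \<open>A\<close> forever without backtracking. Every second vertex of the walk gives such a walk in \<open>B\<close>,
  every fourth one in \<open>C\<close>, and every eighth one again in \<open>A\<close> (\<open>double_step\<close>). Thus \<open>v 0\<close> is a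
  neighbour of \<open>v 8\<close>, whose only neighbours are \<open>v 7\<close> and \<open>v 9\<close>; so \<open>v 0\<close> is one of these, and the
  walk runs around a cycle of length 7 or 9 (\<open>cycle_of_length_7_or_9\<close>). A connected graph
  contains nothing else.

  Conversely, the metamour graph of the graph on the residues modulo \<open>n\<close> with differences \<open>\<plusminus>d\<close> is
  the one with differences \<open>\<plusminus>2d\<close> (\<open>metamour_circulant\<close>). Starting from \<open>d = 1\<close>, the third step
  reaches \<open>8\<close>, which is \<open>\<plusminus>1\<close> exactly when \<open>n\<close> divides 7 or 9.
\<close>

section \<open>Three relations, each the metamour relation of the previous one\<close>

text \<open>
  The metamour operation on adjacency relations alone. Stripping off the vertex sets makes the
  rules for iterating it first-order statements about relations.
\<close>
definition second :: "('a \<Rightarrow> 'a \<Rightarrow> bool) \<Rightarrow> 'a \<Rightarrow> 'a \<Rightarrow> bool" where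
  "second R x y \<longleftrightarrow> x \<noteq> y \<and> \<not> R x y \<and> (\<exists>z. R x z \<and> R z y)"

text \<open>
  \<open>A\<close>, \<open>B\<close>, \<open>C\<close> are the adjacency relations of a graph with \<open>M\<^sup>3(G) = G\<close> and of its first two
  metamour graphs. The axioms are invariant under \<open>A \<mapsto> B \<mapsto> C \<mapsto> A\<close>, so that each lemma below is
  available for all three relations.
\<close>
locale metamour_triple =
  fixes A B C :: "'a \<Rightarrow> 'a \<Rightarrow> bool"
  assumes sym: "A x y \<Longrightarrow> A y x"
    and irrefl: "\<not> A x x"
    and B_eq: "B = second A"
    and C_eq: "C = second B"
    and A_eq: "A = second C"
begin

lemma B_sym: "B x y \<Longrightarrow> B y x"
  using sym by (auto simp: B_eq second_def)

lemma rotate: "metamour_triple B C A"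
proof
  show "B x y \<Longrightarrow> B y x" for x y by (rule B_sym)
  show "\<not> B x x" for x by (simp add: B_eq second_def)
qed (fact C_eq A_eq B_eq)+

lemma C_sym: "C x y \<Longrightarrow> C y x"
  by (rule metamour_triple.B_sym[OF rotate])

lemma step: "A x z \<Longrightarrow> A z y \<Longrightarrow> x \<noteq> y \<Longrightarrow> A x y \<or> B x y"
  unfolding B_eq second_def by blast

lemma disjoint: "A x y \<Longrightarrow> \<not> B x y"
  by (simp add: B_eq second_def)

lemma witness: "B x y \<Longrightarrow> \<exists>z. A x z \<and> A z y"
  by (simp add: B_eq second_def)

lemmas step_B = metamour_triple.step[OF rotate]
lemmas disjoint_B = metamour_triple.disjoint[OF rotate]
lemmas witness_B = metamour_triple.witness[OF rotate]
lemmas rotate2 = metamour_triple.rotate[OF rotate]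
lemmas disjoint_C = metamour_triple.disjoint[OF rotate2]
lemmas witness_C = metamour_triple.witness[OF rotate2]

lemma irrefl_B: "\<not> B x x"
  by (simp add: B_eq second_def)

lemma irrefl_C: "\<not> C x x"
  by (simp add: C_eq second_def)

text \<open>
  Two \<open>B\<close>-edges at a vertex are closed by a \<open>B\<close>-edge or a \<open>C\<close>-edge, and two \<open>A\<close>-edges by an
  \<open>A\<close>-edge or a \<open>B\<close>-edge; disjointness excludes the third relation. Up to rotation, these two
  are the forbidden triangles.
\<close>
lemma no_ABB: "A u v \<Longrightarrow> B u w \<Longrightarrow> B v w \<Longrightarrow> False"
  using step_B[of u w v] B_sym disjoint disjoint_C irrefl by metis

lemma no_AAC: "A u w \<Longrightarrow> A w v \<Longrightarrow> C u v \<Longrightarrow> False"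
  using step[of u w v] irrefl_C disjoint_B disjoint_C by metis

text \<open>
  This is the heart of the matter. Starting from an \<open>A\<close>-triangle \<open>x y z\<close>, the edge \<open>x y\<close> needs a
  \<open>C\<close>-path through some \<open>p\<close>, the edge \<open>x p\<close> a \<open>B\<close>-path through some \<open>q\<close>, and \<open>x q\<close> an \<open>A\<close>-path
  through some \<open>r\<close>. The forbidden triangles turn the last requirement into \<open>A y q\<close> and \<open>A z q\<close>.
  Then \<open>q p\<close> needs an \<open>A\<close>-path through some \<open>s\<close>, and \<open>s\<close> cannot be related consistently to
  \<open>x\<close>, \<open>y\<close> and \<open>z\<close>.
\<close>
lemma no_triangle:
  assumes "A x y" "A y z" "A x z"
  shows False
proof -
  obtain p where p: "C x p" "C p y" using witness_C[OF assms(1)] by blast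
  obtain q where q: "B x q" "B q p" using witness_B[OF p(1)] by blast
  obtain r where r: "A x r" "A r q" using witness[OF q(1)] by blast
  have q_ne: "y \<noteq> q" "z \<noteq> q" using assms q(1) disjoint by blast+
  have q_nB: "\<not> B y q" "\<not> B z q" using no_ABB[OF _ q(1)] assms by blast+
  \<comment> \<open>Otherwise \<open>y r\<close> and \<open>z r\<close> are both \<open>B\<close>-edges, closed by the \<open>A\<close>-edge \<open>y z\<close>.\<close>
  have "A y q \<or> A z q"
  proof (rule ccontr)
    assume not: "\<not> (A y q \<or> A z q)"
    have "B v r" if v: "A x v" "\<not> A v q" "\<not> B v q" "v \<noteq> q" for v
    proof -
      have "v \<noteq> r" using v r by blast
      then have "A v r \<or> B v r" using step[OF sym[OF v(1)] r(1)] by blast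
      moreover have "\<not> A v r" using step[of v r q] v r(2) by blast
      ultimately show ?thesis by blast
    qed
    then have "B y r" "B z r" using not assms q_ne q_nB by blast+
    then show False using no_ABB[of y z r] assms by blast
  qed
  then have yq: "A y q" "A z q"
    using step[of z y q] step[of y z q] assms sym[of y z] q_ne q_nB by blast+
  obtain s where s: "A q s" "A s p" using witness[OF q(2)] by blast
  \<comment> \<open>\<open>C x p\<close> says that \<open>p\<close> is far from \<open>x\<close>, so no \<open>A\<close>-neighbour of \<open>x\<close> is an \<open>A\<close>-neighbour of \<open>p\<close>.\<close>
  have p_far: "\<not> A v p" if "A x v" for v using that no_AAC[of x v p] p by blast
  have "A s q" "A q y" "A q z" "A z x" using s yq assms sym by blast+
  have "s \<noteq> x" using \<open>A s q\<close> q disjoint B_sym by blast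
  have "s \<noteq> y" "s \<noteq> z" using s p_far assms by blast+
  have "\<not> A s y" using no_AAC[of y s p] sym[of s y] s C_sym[OF p(2)] by blast
  then have "B s y" using step[OF \<open>A s q\<close> \<open>A q y\<close> \<open>s \<noteq> y\<close>] by blast
  then have "\<not> B s z" using no_ABB[of y z s] B_sym[of s] assms by blast
  then have "A s z" using step[OF \<open>A s q\<close> \<open>A q z\<close> \<open>s \<noteq> z\<close>] by blast
  have "\<not> A s x" using no_AAC[of x s p] sym[of s x] s p by blast
  then have "B s x" using step[OF \<open>A s z\<close> \<open>A z x\<close> \<open>s \<noteq> x\<close>] by blast
  then show False using no_ABB[of x y s] \<open>B s y\<close> B_sym[of s] assms by blast
qed

lemma second_nbr: "A x z \<Longrightarrow> A z y \<Longrightarrow> x \<noteq> y \<Longrightarrow> B x y"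
  using step no_triangle by blast

text \<open>
  Three \<open>A\<close>-neighbours of a vertex would be pairwise \<open>B\<close>-adjacent, and \<open>B\<close> has no triangle either.
\<close>
lemma degree_le_2:
  assumes "A x a" "A x b" "A x c"
  shows "a = b \<or> b = c \<or> a = c"
  using assms metamour_triple.no_triangle[OF rotate] second_nbr sym by metis

text \<open>
  Without triangles, a \<open>B\<close>-edge is nothing but a non-backtracking \<open>A\<close>-path of length two.
\<close>
lemma B_iff: "B x y \<longleftrightarrow> x \<noteq> y \<and> (\<exists>z. A x z \<and> A z y)"
  using second_nbr by (auto simp: B_eq second_def)

lemmas C_iff = metamour_triple.B_iff[OF rotate]
lemmas A_iff = metamour_triple.B_iff[OF rotate2]

text \<open>
  If \<open>y\<close> were the only \<open>A\<close>-neighbour of \<open>x\<close>, then degrees at most two would force an \<open>A\<close>-path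
  \<open>x y b w a\<close> in which \<open>a\<close> is the \<open>C\<close>-neighbour of \<open>x\<close> that the edge \<open>x y\<close> requires. But \<open>a\<close>
  must also be \<open>C\<close>-adjacent to \<open>y\<close>, hence reachable from \<open>y\<close> in two \<open>B\<close>-steps; the first of these
  can only go to \<open>w\<close>, which would then be both \<open>A\<close>-adjacent and \<open>B\<close>-adjacent to \<open>a\<close>.
\<close>
lemma no_end:
  assumes xy: "A x y"
  obtains z where "A x z" "z \<noteq> y"
proof (rule ccontr)
  assume "\<not> thesis"
  with that have only: "A x z \<Longrightarrow> z = y" for z by blast
  obtain a where a: "C x a" "C a y" using xy A_iff by blast
  obtain b where b: "B x b" "B b a" using a C_iff by blast
  have yb: "A y b" "b \<noteq> x" using b only B_iff by blast+
  obtain w where w: "A b w" "A w a" using b B_iff by blast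
  have "a \<noteq> x" "a \<noteq> b" using a b C_iff B_iff by blast+
  then have "w \<noteq> y" using w yb xy degree_le_2[of y x b a] sym by blast
  obtain u where u: "B y u" "B u a" using a C_iff C_sym by blast
  obtain t where t: "A y t" "A t u" "y \<noteq> u" using u B_iff by blast
  have "t \<noteq> x" using only t by blast
  then have "t = b" using degree_le_2[of y x b t] t yb xy sym by blast
  then have "u = w" using degree_le_2[of b y u w] t yb w \<open>w \<noteq> y\<close> sym by blast
  with u w disjoint show False by blast
qed

section \<open>Walking along the graph\<close>

text \<open>
  If steps of length \<open>d\<close> along \<open>v\<close> form a non-backtracking \<open>A\<close>-walk, then steps of length \<open>2 d\<close>
  form a non-backtracking \<open>B\<close>-walk. Backtracking there would be a 4-cycle in \<open>A\<close>, whose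
  opposite vertices would be each other's only \<open>B\<close>-neighbour, against \<open>no_end\<close> for \<open>B\<close>.
\<close>
lemma double_step:
  fixes v :: "nat \<Rightarrow> 'a"
  assumes step: "\<And>i. A (v i) (v (i + d))" and ne: "\<And>i. v i \<noteq> v (i + 2 * d)"
  shows "B (v i) (v (i + 2 * d))" "v i \<noteq> v (i + 4 * d)"
proof -
  have idx: "i + d + d = i + 2 * d" "i + 2 * d + d = i + 3 * d" "i + 3 * d + d = i + 4 * d"
    "i + d + 2 * d = i + 3 * d" by simp_all
  have st: "A (v i) (v (i + d))" "A (v (i + d)) (v (i + 2 * d))"
    "A (v (i + 2 * d)) (v (i + 3 * d))" "A (v (i + 3 * d)) (v (i + 4 * d))"
    using step[of i] step[of "i + d"] step[of "i + 2 * d"] step[of "i + 3 * d"] by (simp_all only: idx)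
  have n: "v i \<noteq> v (i + 2 * d)" "v (i + d) \<noteq> v (i + 3 * d)"
    using ne[of i] ne[of "i + d"] by (simp_all only: idx not_False_eq_True)
  show B: "B (v i) (v (i + 2 * d))" using st n second_nbr by blast
  show "v i \<noteq> v (i + 4 * d)"
  proof
    assume eq: "v i = v (i + 4 * d)"
    obtain z where z: "B (v i) z" "z \<noteq> v (i + 2 * d)"
      using metamour_triple.no_end[OF rotate B] by blast
    then obtain t where t: "A (v i) t" "A t z" "v i \<noteq> z" using B_iff by blast
    have "A (v i) (v (i + 3 * d))" using sym[OF st(4)] eq by simp
    then have "t = v (i + d) \<or> t = v (i + 3 * d)"
      using degree_le_2[OF t(1) st(1)] n(2) by blast
    then have "A t (v i)" "A t (v (i + 2 * d))"
      using st(2) sym[OF st(1)] sym[OF st(3)] st(4) eq by auto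
    then show False
      using degree_le_2[OF t(2)] z t n(1) by blast
  qed
qed

lemma obtain_walk:
  assumes "A x y"
  obtains v :: "nat \<Rightarrow> 'a" where "\<And>i. A (v i) (v (i + 1))" "\<And>i. v i \<noteq> v (i + 2)"
proof -
  \<comment> \<open>The recursion runs over edges, because the next vertex has to avoid the previous one.\<close>
  have "\<exists>f. \<forall>n. (case f n of (a, b) \<Rightarrow> A a b) \<and>
             (case f n of (a, b) \<Rightarrow> case f (Suc n) of (c, d) \<Rightarrow> c = b \<and> d \<noteq> a)"
  proof (rule dependent_nat_choice)
    show "\<exists>e. case e of (a, b) \<Rightarrow> A a b" using assms by auto
  next
    fix e :: "'a \<times> 'a" and n :: nat
    assume "case e of (a, b) \<Rightarrow> A a b"
    then obtain a b where e: "e = (a, b)" "A b a" using sym by (cases e) auto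
    obtain c where "A b c" "c \<noteq> a" using no_end[OF e(2)] by blast
    then show "\<exists>e'. (case e' of (a, b) \<Rightarrow> A a b) \<and>
                (case e of (a, b) \<Rightarrow> case e' of (c, d) \<Rightarrow> c = b \<and> d \<noteq> a)"
      using e by auto
  qed
  then obtain f where "\<And>n. A (fst (f n)) (snd (f n))" "\<And>n. fst (f (Suc n)) = snd (f n)"
      "\<And>n. snd (f (Suc n)) \<noteq> fst (f n)"
    by (force simp: case_prod_beta)
  then show thesis using that[of "\<lambda>n. fst (f n)"] by (metis Suc_eq_plus1 add_2_eq_Suc')
qed

text \<open>
  Doubling three times leads from \<open>A\<close> through \<open>B\<close> and \<open>C\<close> back to \<open>A\<close>: along a non-backtracking
  \<open>A\<close>-walk \<open>v\<close>, the vertex \<open>v 8\<close> is \<open>A\<close>-adjacent to \<open>v 0\<close>. Its neighbours are also \<open>v 7\<close> and \<open>v 9\<close>,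
  and there are only two, so the walk closes up after 7 or 9 steps. The known relations between
  \<open>v i\<close> and \<open>v (i + 1)\<close>, \<open>v (i + 2)\<close>, \<open>v (i + 4)\<close>, \<open>v (i + 8)\<close> exclude earlier repetitions.
\<close>
lemma cycle_of_length_7_or_9:
  assumes "A x y"
  obtains v :: "nat \<Rightarrow> 'a" and n where "n = 7 \<or> n = 9" "inj_on v {..<n}"
    "\<And>i u. i < n \<Longrightarrow> A (v i) u \<longleftrightarrow> u = v ((i + 1) mod n) \<or> u = v ((i + n - 1) mod n)"
proof -
  obtain v :: "nat \<Rightarrow> 'a" where v1: "\<And>i. A (v i) (v (i + 1))" and n2: "\<And>i. v i \<noteq> v (i + 2)"
    using obtain_walk[OF assms] by blast
  have v2: "B (v i) (v (i + 2))" and n4: "v i \<noteq> v (i + 4)" for i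
    using double_step[of v 1 i] v1 n2 by simp_all
  have v4: "C (v i) (v (i + 4))" and n8: "v i \<noteq> v (i + 8)" for i
    using metamour_triple.double_step[OF rotate, of v 2 i] v2 n4 by simp_all
  have v8: "A (v i) (v (i + 8))" for i
    using metamour_triple.double_step(1)[OF rotate2, of v 4 i] v4 n8 by simp
  have nbr: "u = v i \<or> u = v (i + 2)" if "A (v (i + 1)) u" for i u
    using degree_le_2[of "v (i + 1)" u "v i" "v (i + 2)"] that v1[of i] v1[of "i + 1"] n2[of i] sym
    by auto
  have n1: "v i \<noteq> v (i + 1)" for i using v1[of i] irrefl by metis
  have n3: "v i \<noteq> v (i + 3)" for i
    using no_triangle[of "v i" "v (i + 1)" "v (i + 2)"] v1[of i] v1[of "i + 1"] v1[of "i + 2"] sym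
    by (auto simp: numeral_eq_Suc)
  have n5: "v i \<noteq> v (i + 5)" for i
    using C_sym[OF v4[of i]] v1[of "i + 4"] disjoint_C by (auto simp: add.commute)
  have n6: "v i \<noteq> v (i + 6)" for i
    using C_sym[OF v4[of i]] v2[of "i + 4"] disjoint_B by (auto simp: add.commute)
  have distinct: "v i \<noteq> v j" if "i < j" "j \<le> i + 8" "j \<noteq> i + 7" for i j
  proof -
    obtain k where "j = i + k" using \<open>i < j\<close> less_imp_add_positive by blast
    with that consider "j = i + 1" | "j = i + 2" | "j = i + 3" | "j = i + 4" | "j = i + 5"
      | "j = i + 6" | "j = i + 8" by linarith
    then show ?thesis by cases (simp_all only: n1 n2 n3 n4 n5 n6 n8 not_False_eq_True)
  qed
  note result = that
  have finish: thesis if n: "n = 7 \<or> n = 9" and close: "v n = v 0" and inj: "inj_on v {..<n}" for n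
  proof (rule result[OF n inj])
    fix i u assume "i < n"
    show "A (v i) u \<longleftrightarrow> u = v ((i + 1) mod n) \<or> u = v ((i + n - 1) mod n)"
    proof (cases i)
      case 0
      have "v 1 \<noteq> v (n - 1)" using inj_onD[OF inj, of 1 "n - 1"] n by auto
      moreover have "A (v 0) (v 1)" "A (v 0) (v (n - 1))"
        using v1[of 0] v1[of "n - 1"] n close sym by auto
      ultimately have "A (v 0) u \<longleftrightarrow> u = v 1 \<or> u = v (n - 1)"
        using degree_le_2 by blast
      then show ?thesis using 0 n by auto
    next
      case (Suc j)
      have "v ((i + 1) mod n) = v (j + 2)"
        using \<open>i < n\<close> Suc close by (cases "i + 1 = n") auto
      moreover have "v ((i + n - 1) mod n) = v j"
        using \<open>i < n\<close> Suc by simp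
      ultimately show ?thesis using nbr[of j u] v1[of j] v1[of "j + 1"] sym Suc by auto
    qed
  qed
  consider "v 0 = v 7" | "v 0 = v 9"
    using nbr[of 7 "v 0"] v8[of 0] sym by auto
  then show thesis
  proof cases
    case 1
    have "v i \<noteq> v j" if "i < j" "j < 7" for i j
      using distinct[of i j] that by simp
    then have "inj_on v {..<7}"
      by (intro linorder_inj_onI) auto
    with 1 finish[of 7] show thesis by simp
  next
    case 2
    \<comment> \<open>A repetition after 7 steps is excluded with the help of \<open>v 9 = v 0\<close>.\<close>
    have "v 0 \<noteq> v 7" using v2[of 7] 2 irrefl_B by auto
    moreover have "v 1 \<noteq> v 8"
    proof
      assume "v 1 = v 8"
      then have "v 7 = v 0 \<or> v 7 = v 2" using nbr[of 0 "v 7"] sym[OF v1[of 7]] by (auto simp: numeral_2_eq_2)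
      with \<open>v 0 \<noteq> v 7\<close> distinct[of 2 7] show False by auto
    qed
    ultimately have "v i \<noteq> v j" if "i < j" "j < 9" for i j
    proof (cases "j = i + 7")
      case True
      with that have "i = 0 \<or> i = 1" by linarith
      with True \<open>v 0 \<noteq> v 7\<close> \<open>v 1 \<noteq> v 8\<close> show ?thesis by auto
    next
      case False
      with that distinct[of i j] show ?thesis by simp
    qed
    then have "inj_on v {..<9}"
      by (intro linorder_inj_onI) auto
    with 2 finish[of 9] show thesis by simp
  qed
qed

end

section \<open>Adjacency in metamour graphs\<close>

abbreviation adj :: "'a pair_pre_digraph \<Rightarrow> 'a \<Rightarrow> 'a \<Rightarrow> bool" where
  "adj G x y \<equiv> (x, y) \<in> parcs G"

lemma pair_graph_wf: "pair_graph G \<Longrightarrow> pair_wf_digraph G"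
  by (simp add: pair_graph_def pair_digraph_def pair_fin_digraph_def)

lemma pair_graph_eqI:
  assumes "pverts G = pverts H" "\<And>x y. adj G x y \<longleftrightarrow> adj H x y"
  shows "G = H"
  using assms by (intro pair_pre_digraph.equality) auto

lemma adj_metamour:
  assumes "pair_wf_digraph G"
  shows "adj (metamour_graph G) x y \<longleftrightarrow> second (adj G) x y"
proof -
  interpret pair_wf_digraph G by fact
  show ?thesis
    by (auto simp: metamour_graph_def graph_dist_eq_2_iff second_def
        simp del: numeral_eq_ereal dest: in_arcsD1 in_arcsD2)
qed

lemma pverts_metamour [simp]: "pverts (metamour_graph G) = pverts G"
  by (simp add: metamour_graph_def)

lemma metamour_iterates:
  "(metamour_graph ^^ 1) G = metamour_graph G"
  "(metamour_graph ^^ 2) G = metamour_graph (metamour_graph G)"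
  "(metamour_graph ^^ 3) G = metamour_graph (metamour_graph (metamour_graph G))"
  by (simp_all add: numeral_eq_Suc)

text \<open>
  Period 1 is the only smaller one to exclude, as \<open>M\<^sup>2(G) = G\<close> and \<open>M\<^sup>3(G) = G\<close> give \<open>M(G) = G\<close>.
\<close>
lemma has_metamour_period_3_iff:
  "has_metamour_period G 3 \<longleftrightarrow>
     metamour_graph (metamour_graph (metamour_graph G)) = G \<and> metamour_graph G \<noteq> G"
    (is "_ \<longleftrightarrow> ?M3 = G \<and> ?M1 \<noteq> G")
proof
  assume "has_metamour_period G 3"
  then have "(metamour_graph ^^ 3) G = G" and "(metamour_graph ^^ j) G \<noteq> G" if "0 < j" "j < 3" for j
    using that unfolding has_metamour_period_def by blast+
  from this(1)[of 1] this(2)[of 1] show "?M3 = G \<and> ?M1 \<noteq> G"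
    unfolding metamour_iterates by simp
next
  assume M: "?M3 = G \<and> ?M1 \<noteq> G"
  then have "metamour_graph ?M1 \<noteq> G" by metis
  with M have "(metamour_graph ^^ 1) G \<noteq> G" "(metamour_graph ^^ 2) G \<noteq> G"
    unfolding metamour_iterates by blast+
  moreover have "j = 1 \<or> j = 2" if "0 < j" "j < 3" for j :: nat
    using that by linarith
  ultimately have "(metamour_graph ^^ j) G \<noteq> G" if "0 < j" "j < 3" for j
    using that by blast
  moreover have "(metamour_graph ^^ 3) G = G"
    unfolding metamour_iterates using M by (rule conjunct1)
  ultimately show "has_metamour_period G 3"
    unfolding has_metamour_period_def by (intro conjI allI impI) (simp, assumption, blast)
qed

text \<open>
  The period closes the sequence of iterated metamour graphs to a cycle of three relations.
\<close>
lemma metamour_triple_of_period: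
  assumes G: "pair_graph G"
    and per: "metamour_graph (metamour_graph (metamour_graph G)) = G"
  shows "metamour_triple (adj G) (adj (metamour_graph G)) (adj (metamour_graph (metamour_graph G)))"
proof -
  interpret pair_graph G by fact
  note G1 = pair_graph_metamour_graph[OF G]
  note G2 = pair_graph_metamour_graph[OF G1]
  show ?thesis
  proof
    show "adj G x y \<Longrightarrow> adj G y x" for x y
      using pair_sym_arcs by (auto simp: symmetric_def sym_def)
    show "\<not> adj G x x" for x using pair_no_loops[of "(x, x)"] by auto
    show "adj (metamour_graph G) = second (adj G)"
      by (intro ext) (rule adj_metamour[OF pair_graph_wf[OF G]])
    show "adj (metamour_graph (metamour_graph G)) = second (adj (metamour_graph G))"
      by (intro ext) (rule adj_metamour[OF pair_graph_wf[OF G1]])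
    show "adj G = second (adj (metamour_graph (metamour_graph G)))"
      by (intro ext) (rule adj_metamour[OF pair_graph_wf[OF G2], unfolded per])
  qed
qed

section \<open>Invariance of the metamour period under isomorphism\<close>

definition graph_iso :: "('a \<Rightarrow> 'b) \<Rightarrow> 'a pair_pre_digraph \<Rightarrow> 'b pair_pre_digraph \<Rightarrow> bool" where
  "graph_iso f G H \<longleftrightarrow> bij_betw f (pverts G) (pverts H) \<and>
     (\<forall>x\<in>pverts G. \<forall>y\<in>pverts G. adj G x y \<longleftrightarrow> adj H (f x) (f y))"

text \<open>
  The library notion of isomorphism carries an arc map and endpoint maps, which for pair graphs
  are determined by the vertex map.
\<close>
lemma digraph_iso_with_proj:
  assumes "pair_wf_digraph G" "pair_wf_digraph H"
  shows "digraph_iso (with_proj G) (with_proj H) \<longleftrightarrow> (\<exists>f. graph_iso f G H)"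
proof
  interpret G: pair_wf_digraph G by fact
  interpret H: pair_wf_digraph H by fact
  {
    assume "digraph_iso (with_proj G) (with_proj H)"
    then obtain h where h: "pre_digraph.digraph_isomorphism (with_proj G) h"
      and H: "with_proj H = app_iso h (with_proj G)"
      unfolding digraph_iso_def by blast
    let ?f = "iso_verts h"
    have verts: "pverts H = ?f ` pverts G" and arcs: "parcs H = iso_arcs h ` parcs G"
      and tl: "iso_tail h = fst" and hd: "iso_head h = snd"
      using H by (simp_all add: with_proj_def app_iso_def)
    have ends: "iso_arcs h a = (?f (fst a), ?f (snd a))" if "a \<in> parcs G" for a
      using h that by (auto simp: G.digraph_isomorphism_def tl hd prod_eq_iff)
    have inj: "inj_on ?f (pverts G)"
      using h by (auto simp: G.digraph_isomorphism_def)
    have "graph_iso ?f G H"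
      unfolding graph_iso_def
    proof (intro conjI ballI)
      show "bij_betw ?f (pverts G) (pverts H)" using inj verts by (simp add: bij_betw_def)
      fix x y assume xy: "x \<in> pverts G" "y \<in> pverts G"
      show "adj G x y \<longleftrightarrow> adj H (?f x) (?f y)"
      proof
        assume "adj G x y"
        then show "adj H (?f x) (?f y)" using ends[of "(x, y)"] arcs by (metis fst_conv snd_conv imageI)
      next
        assume "adj H (?f x) (?f y)"
        then obtain a b where ab: "(a, b) \<in> parcs G" "(?f x, ?f y) = iso_arcs h (a, b)"
          unfolding arcs by auto
        then have "?f x = ?f a" "?f y = ?f b" using ends[OF ab(1)] by simp_all
        moreover have "a \<in> pverts G" "b \<in> pverts G" using G.in_arcsD1 G.in_arcsD2 ab(1) by blast+
        ultimately have "x = a" "y = b" using inj_onD[OF inj] xy by blast+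
        with ab(1) show "adj G x y" by simp
      qed
    qed
    then show "\<exists>f. graph_iso f G H" by blast
  next
    assume "\<exists>f. graph_iso f G H"
    then obtain f where bij: "bij_betw f (pverts G) (pverts H)"
      and adj: "\<And>x y. x \<in> pverts G \<Longrightarrow> y \<in> pverts G \<Longrightarrow> adj G x y \<longleftrightarrow> adj H (f x) (f y)"
      unfolding graph_iso_def by blast
    let ?h = "\<lparr> iso_verts = f, iso_arcs = map_prod f f, iso_head = snd, iso_tail = fst \<rparr>"
    have sub: "parcs G \<subseteq> pverts G \<times> pverts G"
      using G.in_arcsD1 G.in_arcsD2 by auto
    have "inj_on (map_prod f f) (parcs G)"
      using bij by (intro inj_on_subset[OF map_prod_inj_on sub]) (simp_all add: bij_betw_def)
    then have "G.digraph_isomorphism ?h"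
      using bij G.wf_digraph_axioms by (auto simp: G.digraph_isomorphism_def bij_betw_def)
    moreover have "parcs H = map_prod f f ` parcs G"
    proof (intro equalityI subsetI)
      fix e assume e: "e \<in> parcs H"
      obtain u w where uw: "e = (u, w)" by (cases e)
      have "u \<in> f ` pverts G" "w \<in> f ` pverts G"
        using H.in_arcsD1 H.in_arcsD2 e bij unfolding uw bij_betw_def by blast+
      then obtain x y where "u = f x" "w = f y" "x \<in> pverts G" "y \<in> pverts G" by blast
      with adj e uw show "e \<in> map_prod f f ` parcs G" by (metis imageI map_prod_simp)
    next
      fix e assume "e \<in> map_prod f f ` parcs G"
      then obtain x y where "e = (f x, f y)" "(x, y) \<in> parcs G" by auto
      with adj sub show "e \<in> parcs H" by blast
    qed
    then have "with_proj H = app_iso ?h (with_proj G)"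
      using bij by (simp add: with_proj_def app_iso_def bij_betw_def)
    ultimately show "digraph_iso (with_proj G) (with_proj H)"
      unfolding digraph_iso_def by blast
  }
qed

lemma graph_iso_metamour:
  assumes "pair_wf_digraph G" "pair_wf_digraph H" "graph_iso f G H"
  shows "graph_iso f (metamour_graph G) (metamour_graph H)"
proof -
  interpret G: pair_wf_digraph G by fact
  interpret H: pair_wf_digraph H by fact
  have bij: "bij_betw f (pverts G) (pverts H)"
    and adj: "\<And>x y. x \<in> pverts G \<Longrightarrow> y \<in> pverts G \<Longrightarrow> adj G x y \<longleftrightarrow> adj H (f x) (f y)"
    using assms(3) unfolding graph_iso_def by blast+
  have "second (adj G) x y \<longleftrightarrow> second (adj H) (f x) (f y)"
    if xy: "x \<in> pverts G" "y \<in> pverts G" for x y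
  proof -
    have "f x = f y \<longleftrightarrow> x = y" using bij xy by (auto simp: bij_betw_def inj_on_def)
    moreover have "(\<exists>z. adj G x z \<and> adj G z y) \<longleftrightarrow> (\<exists>w. adj H (f x) w \<and> adj H w (f y))"
    proof
      assume "\<exists>z. adj G x z \<and> adj G z y"
      then show "\<exists>w. adj H (f x) w \<and> adj H w (f y)" using adj G.in_arcsD2 xy by metis
    next
      assume "\<exists>w. adj H (f x) w \<and> adj H w (f y)"
      then obtain w where w: "adj H (f x) w" "adj H w (f y)" by blast
      then obtain z where "w = f z" "z \<in> pverts G"
        using H.in_arcsD2 bij unfolding bij_betw_def by blast
      with w adj xy show "\<exists>z. adj G x z \<and> adj G z y" by blast
    qed
    ultimately show ?thesis using adj xy by (simp add: second_def)
  qed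
  with bij show ?thesis
    by (simp add: graph_iso_def adj_metamour assms)
qed

text \<open>
  Equality of labelled graphs on a common vertex set is transported along one and the same
  vertex map; this is why the metamour period is an isomorphism invariant.
\<close>
lemma graph_iso_eq_iff:
  assumes "pair_wf_digraph G" "pair_wf_digraph G'" "pair_wf_digraph H" "pair_wf_digraph H'"
    and "pverts G' = pverts G" "pverts H' = pverts H"
    and "graph_iso f G H" "graph_iso f G' H'"
  shows "G = G' \<longleftrightarrow> H = H'"
proof -
  interpret G: pair_wf_digraph G by fact
  interpret G': pair_wf_digraph G' by fact
  interpret H: pair_wf_digraph H by fact
  interpret H': pair_wf_digraph H' by fact
  have im: "pverts H = f ` pverts G"
    using assms(7) by (simp add: graph_iso_def bij_betw_def)
  have "G = G' \<longleftrightarrow> (\<forall>x\<in>pverts G. \<forall>y\<in>pverts G. adj G x y \<longleftrightarrow> adj G' x y)"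
    using assms(5) by (auto intro!: pair_pre_digraph.equality dest: G.in_arcsD1 G.in_arcsD2 G'.in_arcsD1 G'.in_arcsD2)
  moreover have "H = H' \<longleftrightarrow> (\<forall>x\<in>pverts H. \<forall>y\<in>pverts H. adj H x y \<longleftrightarrow> adj H' x y)"
    using assms(6) by (auto intro!: pair_pre_digraph.equality dest: H.in_arcsD1 H.in_arcsD2 H'.in_arcsD1 H'.in_arcsD2)
  ultimately show ?thesis
    using assms(5-8) by (simp add: im graph_iso_def)
qed

lemma has_metamour_period_iso:
  assumes "pair_graph G" "pair_graph H" "graph_iso f G H"
  shows "has_metamour_period G k \<longleftrightarrow> has_metamour_period H k"
proof -
  have pg: "pair_graph K \<Longrightarrow> pair_graph ((metamour_graph ^^ j) K)" for K :: "'c pair_pre_digraph" and j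
    by (induction j) (simp_all add: pair_graph_metamour_graph)
  have pv: "pverts ((metamour_graph ^^ j) K) = pverts K" for K :: "'c pair_pre_digraph" and j
    by (induction j) simp_all
  have iso: "graph_iso f ((metamour_graph ^^ j) G) ((metamour_graph ^^ j) H)" for j
    by (induction j) (simp_all add: assms graph_iso_metamour pair_graph_wf pg)
  have "(metamour_graph ^^ j) G = G \<longleftrightarrow> (metamour_graph ^^ j) H = H" for j
    by (rule graph_iso_eq_iff[where f = f]) (simp_all add: assms pair_graph_wf pg pv iso)
  then show ?thesis by (simp add: has_metamour_period_def)
qed

section \<open>The cycles of length 7 and 9\<close>

text \<open>
  Metamour graphs of the cycles in question are again of this kind, with steps other than 1.
\<close>
definition circulant :: "nat \<Rightarrow> nat \<Rightarrow> nat pair_pre_digraph" where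
  "circulant n d = \<lparr> pverts = {..<n},
     parcs = {(i, j). i < n \<and> j < n \<and> (j = (i + d) mod n \<or> i = (j + d) mod n)} \<rparr>"

lemma cycle_graph_eq_circulant: "cycle_graph n = circulant n 1"
  by (simp add: cycle_graph_def circulant_def)

lemma eq_pred_mod_iff:
  fixes i j n :: nat
  assumes "i < n" "j < n"
  shows "j = (i + n - 1) mod n \<longleftrightarrow> i = (j + 1) mod n"
proof (cases i)
  case 0
  then show ?thesis using assms by (cases "j + 1 = n") auto
next
  case (Suc k)
  then have "(i + n - 1) mod n = k" using assms by simp
  then show ?thesis using assms Suc by (cases "j + 1 = n") auto
qed

lemma adj_circulant:
  "adj (circulant n d) i j \<longleftrightarrow> i < n \<and> j < n \<and> (j = (i + d) mod n \<or> i = (j + d) mod n)"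
  by (simp add: circulant_def)

lemma circulant_pred: "circulant n (n - 1) = circulant n 1"
proof (rule pair_graph_eqI)
  fix i j
  show "adj (circulant n (n - 1)) i j \<longleftrightarrow> adj (circulant n 1) i j"
    using eq_pred_mod_iff[of i n j] eq_pred_mod_iff[of j n i] by (auto simp: adj_circulant)
qed (simp add: circulant_def)

lemma circulant_add_modulus: "circulant n (d + n) = circulant n d"
  unfolding circulant_def by (simp flip: add.assoc)

text \<open>
  Vertices joined by two steps of \<open>\<plusminus>d\<close> differ by \<open>0\<close> or \<open>\<plusminus>2d\<close>. The hypotheses say that modulo \<open>n\<close>
  a difference \<open>\<plusminus>2d\<close> is distinct from \<open>0\<close> and from \<open>\<plusminus>d\<close>, so such vertices are at distance two.
\<close>
lemma metamour_circulant:
  assumes d2: "\<not> n dvd 2 * d" and d3: "\<not> n dvd 3 * d"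
  shows "metamour_graph (circulant n d) = circulant n (2 * d)"
proof -
  let ?A = "adj (circulant n d)"
  have wf: "pair_wf_digraph (circulant n d)"
    by unfold_locales (auto simp: circulant_def)
  note A = adj_circulant[where n = n and d = d]
  have shift: "\<not> [i + e = i] (mod n)" if "\<not> n dvd e" for i e
    using that by (simp add: cong_add_lcancel_0_nat cong_0_iff)
  have unique: "i = j" if "i < n" "j < n" "(i + d) mod n = (j + d) mod n" for i j
    using that cong_add_rcancel_nat[of i d j n] cong_less_modulus_unique_nat[of i j n]
    by (simp add: cong_def)
  have to: "second ?A i j" if i: "i < n" and j: "j = (i + 2 * d) mod n" for i j
  proof -
    have "j < n" using i j by simp
    have ij: "i \<noteq> j" using shift[OF d2, of i] i j by (auto simp: cong_def)
    have "\<not> ?A i j"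
    proof
      assume "?A i j"
      then consider "j = (i + d) mod n" | "i = (j + d) mod n" unfolding A by blast
      then show False
      proof cases
        case 1
        with j have "[i + d + d = i + d] (mod n)" by (simp add: cong_def mult_2 add.assoc)
        \<comment> \<open>\<open>2d \<equiv> d\<close> would give \<open>d \<equiv> 0\<close>, and so \<open>2d \<equiv> 0\<close>.\<close>
        moreover have "\<not> n dvd d" using d2 by (meson dvd_mult)
        ultimately show False using shift by blast
      next
        case 2
        then have "i = ((i + 2 * d) mod n + d) mod n" unfolding j .
        also have "\<dots> = (i + 3 * d) mod n" by (simp add: mod_add_left_eq) (simp add: add.commute)
        finally have "i = (i + 3 * d) mod n" .
        with i have "[i + 3 * d = i] (mod n)" by (simp add: cong_def)
        with shift d3 show False by blast
      qed
    qed
    moreover have "?A i ((i + d) mod n)" "?A ((i + d) mod n) j"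
      using i j \<open>j < n\<close> by (simp_all add: A mod_simps mult_2 add.assoc)
    ultimately show ?thesis using ij unfolding second_def by blast
  qed
  have sym: "second ?A j i \<Longrightarrow> second ?A i j" for i j
    unfolding second_def A by blast
  have "second ?A i j \<longleftrightarrow> adj (circulant n (2 * d)) i j" for i j
  proof
    assume "second ?A i j"
    then obtain z where "i \<noteq> j" and iz: "?A i z" and zj: "?A z j"
      unfolding second_def by blast
    then have lt: "i < n" "j < n" unfolding A by blast+
    from iz zj consider "z = (i + d) mod n" "j = (z + d) mod n" | "z = (i + d) mod n" "z = (j + d) mod n"
      | "i = (z + d) mod n" "j = (z + d) mod n" | "i = (z + d) mod n" "z = (j + d) mod n"
      unfolding A by blast
    then have "j = (i + 2 * d) mod n \<or> i = (j + 2 * d) mod n"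
    proof cases
      case 1 then show ?thesis by (simp add: mod_simps mult_2 add.assoc)
    next
      case 2 then show ?thesis using unique[OF lt] \<open>i \<noteq> j\<close> by simp
    next
      case 3 then show ?thesis using \<open>i \<noteq> j\<close> by simp
    next
      case 4 then show ?thesis by (simp add: mod_simps mult_2 add.assoc)
    qed
    with lt show "adj (circulant n (2 * d)) i j" by (simp add: circulant_def)
  next
    assume "adj (circulant n (2 * d)) i j"
    then show "second ?A i j" using to sym by (auto simp: circulant_def)
  qed
  with wf show ?thesis
    by (intro pair_graph_eqI) (simp_all only: adj_metamour, simp add: circulant_def)
qed

text \<open>
  The step is doubled from 1 through 2 and 4 to 8, which is \<open>1\<close> modulo \<open>7\<close> and \<open>-1\<close> modulo \<open>9\<close>.
\<close>
lemma has_metamour_period_3_cycle_graph: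
  assumes n: "n = 7 \<or> n = 9"
  shows "has_metamour_period (cycle_graph n) 3"
proof -
  have M: "metamour_graph (circulant n 1) = circulant n 2"
    "metamour_graph (circulant n 2) = circulant n 4"
    "metamour_graph (circulant n 4) = circulant n 8"
    using n metamour_circulant[of n 1] metamour_circulant[of n 2] metamour_circulant[of n 4]
    by auto
  have "circulant n 8 = circulant n 1"
    using n circulant_add_modulus[of 7 1] circulant_pred[of 9] by auto
  moreover have "(0, 1) \<in> parcs (circulant n 1)" "(0, 1) \<notin> parcs (circulant n 2)"
    using n by (auto simp: circulant_def)
  then have "circulant n 2 \<noteq> circulant n 1" by metis
  ultimately show ?thesis
    unfolding cycle_graph_eq_circulant has_metamour_period_3_iff M by simp
qed

lemma connected_cycle_graph:
  assumes "n \<ge> 3"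
  shows "Digraph_Component.connected (with_proj (cycle_graph n))"
proof -
  interpret pair_graph "cycle_graph n" using assms by (rule pair_graph_cycle_graph)
  have from_0: "0 \<rightarrow>\<^sup>*\<^bsub>with_proj (cycle_graph n)\<^esub> k" if "k < n" for k
    using that
  proof (induction k)
    case 0
    then show ?case by (intro reachable_refl) (simp add: cycle_graph_def)
  next
    case (Suc k)
    then have "(k, Suc k) \<in> parcs (cycle_graph n)" by (simp add: cycle_graph_def)
    with Suc show ?case by (auto intro: reachable_adj_trans)
  qed
  have "u \<rightarrow>\<^sup>*\<^bsub>with_proj (cycle_graph n)\<^esub> w" if "u < n" "w < n" for u w
    using symmetric_reachable[OF pair_sym_arcs from_0[OF that(1)]] from_0[OF that(2)]
    by (rule reachable_trans)
  moreover have "pverts (cycle_graph n) = {..<n}" by (simp add: cycle_graph_def)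
  ultimately show ?thesis
    using assms
    by (intro connectedI) (auto simp: reachable_mk_symmetric_eq[OF pair_sym_arcs] lessThan_empty_iff)
qed

section \<open>Connected graphs with metamour period 3\<close>

text \<open>
  The cycle of length 7 or 9 contains all neighbours of its vertices, so by connectedness it is
  the whole graph. Excluding period 1 provides an edge to start from: without edges, the
  metamour graph would be the graph itself.
\<close>
lemma period_3_imp_iso_cycle_graph:
  assumes G: "pair_graph G" and conn: "Digraph_Component.connected (with_proj G)"
    and per: "has_metamour_period G 3"
  shows "\<exists>n v. (n = 7 \<or> n = 9) \<and> graph_iso v (cycle_graph n) G"
proof -
  interpret pair_graph G by fact
  have per3: "metamour_graph (metamour_graph (metamour_graph G)) = G" and "metamour_graph G \<noteq> G"
    using per by (simp_all add: has_metamour_period_3_iff)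
  have "parcs G \<noteq> {}"
  proof
    assume "parcs G = {}"
    then have "metamour_graph G = G"
      by (intro pair_graph_eqI) (simp_all add: adj_metamour[OF pair_graph_wf[OF G]] second_def)
    with \<open>metamour_graph G \<noteq> G\<close> show False ..
  qed
  then obtain x y where "adj G x y" by auto
  interpret T: metamour_triple "adj G" "adj (metamour_graph G)"
      "adj (metamour_graph (metamour_graph G))"
    by (rule metamour_triple_of_period[OF G per3])
  obtain v n where n: "n = 7 \<or> n = (9::nat)" and inj: "inj_on v {..<n}"
    and nbrs: "\<And>i u. i < n \<Longrightarrow> adj G (v i) u \<longleftrightarrow> u = v ((i + 1) mod n) \<or> u = v ((i + n - 1) mod n)"
    by (rule T.cycle_of_length_7_or_9[OF \<open>adj G x y\<close>]) (rule that, assumption+)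
  have "n > 0" using n by auto
  have v_in: "v i \<in> pverts G" if "i < n" for i
    using nbrs[OF that] in_arcsD1 by blast
  have "u \<in> v ` {..<n}" if "u \<in> pverts G" for u
  proof -
    have "v 0 \<rightarrow>\<^sup>*\<^bsub>mk_symmetric (with_proj G)\<^esub> u"
      using conn v_in[OF \<open>n > 0\<close>] that
      unfolding Digraph_Component.connected_def strongly_connected_def by simp
    then have "v 0 \<rightarrow>\<^sup>*\<^bsub>with_proj G\<^esub> u"
      by (simp only: reachable_mk_symmetric_eq[OF pair_sym_arcs])
    then show ?thesis
    proof (induction rule: reachable_induct)
      case base
      then show ?case using \<open>n > 0\<close> by simp
    next
      case (step a b)
      obtain i where "i < n" "a = v i" using step.IH by blast
      with step.hyps have "b = v ((i + 1) mod n) \<or> b = v ((i + n - 1) mod n)"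
        using nbrs by simp
      with \<open>n > 0\<close> show ?case by auto
    qed
  qed
  then have "bij_betw v (pverts (cycle_graph n)) (pverts G)"
    using inj v_in unfolding bij_betw_def cycle_graph_def by auto
  moreover have "adj (cycle_graph n) i j \<longleftrightarrow> adj G (v i) (v j)" if "i < n" "j < n" for i j
  proof -
    have eq: "v j = v k \<longleftrightarrow> j = k" if "k < n" for k
      using inj_on_eq_iff[OF inj] \<open>j < n\<close> that by simp
    have "adj G (v i) (v j) \<longleftrightarrow> j = (i + 1) mod n \<or> j = (i + n - 1) mod n"
      using nbrs[OF \<open>i < n\<close>, of "v j"] eq \<open>n > 0\<close> by simp
    then show ?thesis
      using that unfolding eq_pred_mod_iff[OF that] by (simp add: cycle_graph_def)
  qed
  ultimately have "graph_iso v (cycle_graph n) G"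
    by (simp add: graph_iso_def) (simp add: cycle_graph_def)
  with n show ?thesis by blast
qed

lemma iso_cycle_graph_imp_period_3:
  assumes G: "pair_graph G" and n: "n = 7 \<or> n = 9"
    and iso: "digraph_iso (with_proj G) (with_proj (cycle_graph n))"
  shows "Digraph_Component.connected (with_proj G)" "has_metamour_period G 3"
proof -
  have C: "pair_graph (cycle_graph n)" using n by (auto intro!: pair_graph_cycle_graph)
  interpret C: pair_graph "cycle_graph n" by fact
  have wf: "wf_digraph (with_proj G)" using pair_graph_wf[OF G] by (simp add: wf_digraph_wp_iff)
  obtain h where "C.digraph_isomorphism h" "with_proj G = app_iso h (with_proj (cycle_graph n))"
    using digraph_iso_swap[OF wf iso] unfolding digraph_iso_def by blast
  then show "Digraph_Component.connected (with_proj G)"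
    using C.connectedI_app_iso[OF connected_cycle_graph] n by auto
  obtain f where "graph_iso f G (cycle_graph n)"
    using iso digraph_iso_with_proj[OF pair_graph_wf[OF G] pair_graph_wf[OF C]] by blast
  then show "has_metamour_period G 3"
    using has_metamour_period_iso[OF G C] has_metamour_period_3_cycle_graph[OF n] by blast
qed

theorem theorem7p5:
  fixes G :: "'a pair_pre_digraph"
  assumes "pair_graph G"
  shows "Digraph_Component.connected (with_proj G) \<and> has_metamour_period G 3 \<longleftrightarrow>
         digraph_iso (with_proj G) (with_proj (cycle_graph 7)) \<or>
         digraph_iso (with_proj G) (with_proj (cycle_graph 9))"
proof
  assume "Digraph_Component.connected (with_proj G) \<and> has_metamour_period G 3"
  then obtain n v where n: "n = 7 \<or> n = 9" and "graph_iso v (cycle_graph n) G"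
    using period_3_imp_iso_cycle_graph[OF assms] by blast
  moreover have C: "pair_wf_digraph (cycle_graph n)"
    using n by (auto intro!: pair_graph_wf pair_graph_cycle_graph)
  ultimately have "digraph_iso (with_proj (cycle_graph n)) (with_proj G)"
    using digraph_iso_with_proj pair_graph_wf[OF assms] by blast
  then have "digraph_iso (with_proj G) (with_proj (cycle_graph n))"
    using digraph_iso_swap C by (metis wf_digraph_wp_iff)
  with n show "digraph_iso (with_proj G) (with_proj (cycle_graph 7)) \<or>
      digraph_iso (with_proj G) (with_proj (cycle_graph 9))"
    by blast
qed (use iso_cycle_graph_imp_period_3[OF assms] in blast)

end
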